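(* Let $S$ be a given finite choice set of products. (i) The binary Ising model on $S$ is equivalent to the multivariate logit model (MVL) on $S$: for every real symmetric matrix $\theta$ indexed by $S$, the two models with parameters $\theta$ assign the same probability to every basket from $S$. (ii) The spin Ising model on $S$ is equivalent to the MVL on $S$ up to a parameter transformation: there are a map $\tilde\theta\mapsto\theta$ and a map $\theta\mapsto\tilde\theta$ between real symmetric matrices indexed by $S$ such that the spin Ising model with parameters $\tilde\theta$ and the MVL with the corresponding parameters $\theta$ (under either map) assign the same probability to every basket from $S$.
   Context: A basket from $S$ is a subset $b\subseteq S$. Its binary representation is $x\in\{0,1\}^S$ with $x_i=1$ iff $i\in b$; its spin representation is $\tilde x\in\{-1,1\}^S$ with $\tilde x_i=1$ iff $i\in b$. The binary Ising model with symmetric parameters $\theta$ assigns basket $x$ the probability $$p_\theta(x\mid S)=\exp\Bigl(\sum_{i\in S}\theta_{ii}x_i+\sum_{i\ne j,\ i,j\in S}x_i\theta_{ij}x_j-A_\theta(S)\Bigr),\quad A_\theta(S)=\log\sum_{y\in\{0,1\}^S}\exp\Bigl(\sum_{i\in S}\theta_{ii}y_i+\sum_{i\ne j,\ i,j\in S}y_i\theta_{ij}y_j\Bigr).$$ The spin Ising model with symmetric parameters $\tilde\theta$ is given by the same formulas with $\theta$ replaced by $\tilde\theta$, $x$ by $\tilde x$, and $\{0,1\}^S$ by $\{-1,1\}^S$. The MVL with parameters $\theta$ is the multinomial logit model whose alternatives are all baskets from $S$, basket $x$ having deterministic utility $V_\theta(x)=\sum_{i\in S}\theta_{ii}x_i+\sum_{i\ne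 j,\ i,j\in S}x_i\theta_{ij}x_j$; that is, basket $x$ is chosen with probability $e^{V_\theta(x)}/\sum_{y\in\{0,1\}^S}e^{V_\theta(y)}$. Sums over $i\ne j$ run over ordered pairs. *)

theory Defs
  imports Complex_Main "HOL-Library.FuncSet"
begin

text \<open>
  Real symmetric matrices indexed by \<open>S\<close>; they are extensional (\<open>undefined\<close> outside
  \<open>S \<times> S\<close>), so that each such matrix has exactly one representative.
\<close>

definition symmetric_matrices :: "'a set \<Rightarrow> ('a \<Rightarrow> 'a \<Rightarrow> real) set" where
  "symmetric_matrices S =
     {\<theta> \<in> S \<rightarrow>\<^sub>E (S \<rightarrow>\<^sub>E UNIV). \<forall>i\<in>S. \<forall>j\<in>S. \<theta> i j = \<theta> j i}"

definition binary_rep :: "'a set \<Rightarrow> 'a set \<Rightarrow> 'a \<Rightarrow> real" where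
  "binary_rep S b = (\<lambda>i\<in>S. if i \<in> b then 1 else 0)"

definition spin_rep :: "'a set \<Rightarrow> 'a set \<Rightarrow> 'a \<Rightarrow> real" where
  "spin_rep S b = (\<lambda>i\<in>S. if i \<in> b then 1 else - 1)"

text \<open>The second sum ranges over ordered pairs, so each unordered pair is counted twice.\<close>

definition utility :: "'a set \<Rightarrow> ('a \<Rightarrow> 'a \<Rightarrow> real) \<Rightarrow> ('a \<Rightarrow> real) \<Rightarrow> real" where
  "utility S \<theta> x =
     (\<Sum>i\<in>S. \<theta> i i * x i) +
     (\<Sum>(i, j)\<in>{(i, j). i \<in> S \<and> j \<in> S \<and> i \<noteq> j}. x i * \<theta> i j * x j)"

text \<open>
  The Ising model with state space \<open>K\<close> at each site: \<open>K = {0, 1}\<close> is the binary model,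
  \<open>K = {-1, 1}\<close> the spin model.
\<close>

definition log_partition :: "real set \<Rightarrow> 'a set \<Rightarrow> ('a \<Rightarrow> 'a \<Rightarrow> real) \<Rightarrow> real" where
  "log_partition K S \<theta> = ln (\<Sum>y\<in>S \<rightarrow>\<^sub>E K. exp (utility S \<theta> y))"

definition ising_prob ::
  "real set \<Rightarrow> 'a set \<Rightarrow> ('a \<Rightarrow> 'a \<Rightarrow> real) \<Rightarrow> ('a \<Rightarrow> real) \<Rightarrow> real" where
  "ising_prob K S \<theta> x = exp (utility S \<theta> x - log_partition K S \<theta>)"

definition binary_ising_prob :: "'a set \<Rightarrow> ('a \<Rightarrow> 'a \<Rightarrow> real) \<Rightarrow> 'a set \<Rightarrow> real" where
  "binary_ising_prob S \<theta> b = ising_prob {0, 1} S \<theta> (binary_rep S b)"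

definition spin_ising_prob :: "'a set \<Rightarrow> ('a \<Rightarrow> 'a \<Rightarrow> real) \<Rightarrow> 'a set \<Rightarrow> real" where
  "spin_ising_prob S \<theta> b = ising_prob {- 1, 1} S \<theta> (spin_rep S b)"

text \<open>
  Multinomial logit with set of alternatives \<open>C\<close> and deterministic utility \<open>V\<close>.  The
  alternatives of the MVL are the baskets from \<open>S\<close>, in binary representation.
\<close>

definition mnl_prob :: "'c set \<Rightarrow> ('c \<Rightarrow> real) \<Rightarrow> 'c \<Rightarrow> real" where
  "mnl_prob C V a = exp (V a) / (\<Sum>c\<in>C. exp (V c))"

definition mvl_prob :: "'a set \<Rightarrow> ('a \<Rightarrow> 'a \<Rightarrow> real) \<Rightarrow> 'a set \<Rightarrow> real" where
  "mvl_prob S \<theta> b = mnl_prob (S \<rightarrow>\<^sub>E {0, 1}) (utility S \<theta>) (binary_rep S b)"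

end

theory Submission
  imports Defs
begin

text \<open>
  The binary Ising model writes in exponential-family form, with the normalising constant as a
  logarithm in the exponent, what the logit model writes as a quotient; the normalising sum is
  positive because the configuration space is finite and nonempty.

  The spin model reduces to the binary one by the affine change of variables \<open>y = 2 x - 1\<close> at
  every site.  It maps a quadratic utility to a quadratic utility plus a constant:
  expanding \<open>\<theta>\<^sub>i\<^sub>j (2 x\<^sub>i - 1) (2 x\<^sub>j - 1)\<close> multiplies each interaction by 4, moves a linear
  contribution of the interactions onto the diagonal (by symmetry, the \<open>x\<^sub>i\<close> and the \<open>x\<^sub>j\<close>
  terms contribute equally), and leaves a constant independent of the configuration
  (\<open>utility_spin_of_binary\<close>).  Logit probabilities do not change under relabelling of the
  alternatives and a constant shift of the utility (\<open>mnl_prob_reindex_shift\<close>), which gives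
  the map from spin to binary parameters.  The reverse map is its right inverse: the interactions
  are recovered first, then the diagonal.
\<close>

lemma ising_prob_eq_mnl_prob:
  assumes "finite S" "finite K" "K \<noteq> {}"
  shows "ising_prob K S \<theta> x = mnl_prob (S \<rightarrow>\<^sub>E K) (utility S \<theta>) x"
proof -
  have "(\<Sum>y\<in>S \<rightarrow>\<^sub>E K. exp (utility S \<theta> y)) > 0"
    using assms by (intro sum_pos finite_PiE) (auto simp: PiE_eq_empty_iff)
  then show ?thesis
    by (simp add: ising_prob_def mnl_prob_def log_partition_def exp_diff)
qed

text \<open>A constant added to all utilities contributes the same factor to numerator and denominator.\<close>

lemma mnl_prob_reindex_shift:
  assumes f: "bij_betw f C D" and shift: "\<And>c. c \<in> C \<Longrightarrow> W (f c) = V c + k" and "a \<in> C"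
  shows "mnl_prob D W (f a) = mnl_prob C V a"
proof -
  have "(\<Sum>d\<in>D. exp (W d)) = (\<Sum>c\<in>C. exp (W (f c)))"
    by (rule sum.reindex_bij_betw[OF f, symmetric])
  also have "\<dots> = exp k * (\<Sum>c\<in>C. exp (V c))"
    by (simp add: shift exp_add sum_distrib_left mult.commute)
  finally show ?thesis
    using \<open>a \<in> C\<close> by (simp add: mnl_prob_def shift exp_add)
qed

definition spin_of_binary :: "'a set \<Rightarrow> ('a \<Rightarrow> real) \<Rightarrow> 'a \<Rightarrow> real" where
  "spin_of_binary S x = (\<lambda>i\<in>S. 2 * x i - 1)"

lemma spin_of_binary_rep: "spin_of_binary S (binary_rep S b) = spin_rep S b"
  by (auto simp: spin_of_binary_def binary_rep_def spin_rep_def)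

lemma bij_betw_spin_of_binary:
  "bij_betw (spin_of_binary S) (S \<rightarrow>\<^sub>E {0, 1}) (S \<rightarrow>\<^sub>E {- 1, 1})"
proof (rule bij_betwI)
  let ?g = "\<lambda>y. \<lambda>i\<in>S. (y i + 1) / 2 :: real"
  show "spin_of_binary S \<in> (S \<rightarrow>\<^sub>E {0, 1}) \<rightarrow> (S \<rightarrow>\<^sub>E {- 1, 1})"
    by (fastforce simp: spin_of_binary_def PiE_iff)
  show "?g \<in> (S \<rightarrow>\<^sub>E {- 1, 1}) \<rightarrow> (S \<rightarrow>\<^sub>E {0, 1})"
    by (fastforce simp: PiE_iff)
  show "?g (spin_of_binary S x) = x" if "x \<in> S \<rightarrow>\<^sub>E {0, 1}" for x
    using that by (auto simp: spin_of_binary_def PiE_iff extensional_def fun_eq_iff)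
  show "spin_of_binary S (?g y) = y" if "y \<in> S \<rightarrow>\<^sub>E {- 1, 1}" for y
    using that by (auto simp: spin_of_binary_def PiE_iff extensional_def fun_eq_iff)
qed

text \<open>
  The coefficients of \<open>\<theta>\<^sub>i\<^sub>i (2 x\<^sub>i - 1)\<close> and \<open>\<theta>\<^sub>i\<^sub>j (2 x\<^sub>i - 1) (2 x\<^sub>j - 1)\<close>, summed over
  ordered pairs, in powers of \<open>x\<close>.  Of the factor 4 on the diagonal, 2 comes from the pairs
  \<open>(i, k)\<close> and 2 from the pairs \<open>(k, i)\<close>.
\<close>

definition binary_params :: "'a set \<Rightarrow> ('a \<Rightarrow> 'a \<Rightarrow> real) \<Rightarrow> 'a \<Rightarrow> 'a \<Rightarrow> real" where
  "binary_params S \<theta> =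
     (\<lambda>i\<in>S. \<lambda>j\<in>S. if i = j then 2 * \<theta> i i - 4 * (\<Sum>k\<in>S - {i}. \<theta> i k) else 4 * \<theta> i j)"

text \<open>
  The solution \<open>\<theta>'\<close> of \<open>binary_params S \<theta>' = \<theta>\<close>; since \<open>\<theta>'\<^sub>i\<^sub>k = \<theta>\<^sub>i\<^sub>k / 4\<close>,
  the factor 4 in the row sum cancels.
\<close>

definition spin_params :: "'a set \<Rightarrow> ('a \<Rightarrow> 'a \<Rightarrow> real) \<Rightarrow> 'a \<Rightarrow> 'a \<Rightarrow> real" where
  "spin_params S \<theta> =
     (\<lambda>i\<in>S. \<lambda>j\<in>S. if i = j then (\<theta> i i + (\<Sum>k\<in>S - {i}. \<theta> i k)) / 2 else \<theta> i j / 4)"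

lemma binary_params_symmetric:
  assumes "\<theta> \<in> symmetric_matrices S"
  shows "binary_params S \<theta> \<in> symmetric_matrices S"
  using assms by (auto simp: symmetric_matrices_def binary_params_def)

lemma spin_params_symmetric:
  assumes "\<theta> \<in> symmetric_matrices S"
  shows "spin_params S \<theta> \<in> symmetric_matrices S"
  using assms by (auto simp: symmetric_matrices_def spin_params_def)

lemma binary_params_spin_params:
  assumes "\<theta> \<in> symmetric_matrices S"
  shows "binary_params S (spin_params S \<theta>) = \<theta>"
proof (intro ext)
  fix i j
  have row: "(\<Sum>k\<in>S - {i}. spin_params S \<theta> i k) = (\<Sum>k\<in>S - {i}. \<theta> i k) / 4" if "i \<in> S"
    unfolding sum_divide_distrib using that by (intro sum.cong) (auto simp: spin_params_def)
  have "\<theta> i = undefined" if "i \<notin> S"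
    using assms that by (auto simp: symmetric_matrices_def PiE_iff extensional_def)
  moreover have "\<theta> i j = undefined" if "i \<in> S" "j \<notin> S"
    using assms that by (auto simp: symmetric_matrices_def PiE_iff extensional_def)
  moreover have "binary_params S (spin_params S \<theta>) i j = \<theta> i j" if "i \<in> S" "j \<in> S"
    using that row by (auto simp: binary_params_def) (auto simp: spin_params_def field_simps)
  ultimately show "binary_params S (spin_params S \<theta>) i j = \<theta> i j"
    by (cases "i \<in> S"; cases "j \<in> S") (simp_all add: binary_params_def)
qed

text \<open>The constant is found at \<open>x = 0\<close>, where every spin is \<open>- 1\<close> and the binary utility vanishes.\<close>

lemma utility_spin_of_binary:
  assumes "finite S" and sym: "\<theta> \<in> symmetric_matrices S"
  shows "utility S \<theta> (spin_of_binary S x) =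
    utility S (binary_params S \<theta>) x + utility S \<theta> (\<lambda>_. - 1)"
proof -
  define D where "D = {(i, j). i \<in> S \<and> j \<in> S \<and> i \<noteq> j}"
  have D_Sigma: "D = Sigma S (\<lambda>i. S - {i})"
    by (auto simp: D_def)
  define lin where "lin = (\<Sum>(i, j)\<in>D. \<theta> i j * x i)"
  have lin_rows: "lin = (\<Sum>i\<in>S. (\<Sum>k\<in>S - {i}. \<theta> i k) * x i)"
    unfolding lin_def D_Sigma using \<open>finite S\<close>
    by (subst sum.Sigma[symmetric]) (auto simp: sum_distrib_right)
  have lin_swap: "(\<Sum>(i, j)\<in>D. \<theta> i j * x j) = lin"
    unfolding lin_def using sym
    by (intro sum.reindex_bij_witness[where i = prod.swap and j = prod.swap])
       (auto simp: D_def symmetric_matrices_def)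
  define quad where "quad = (\<Sum>(i, j)\<in>D. x i * \<theta> i j * x j)"
  define diag where "diag = (\<Sum>i\<in>S. \<theta> i i * x i)"
  have "(\<Sum>i\<in>S. \<theta> i i * spin_of_binary S x i) = 2 * diag - (\<Sum>i\<in>S. \<theta> i i)"
    unfolding diag_def sum_distrib_left sum_subtractf[symmetric]
    by (intro sum.cong) (auto simp: spin_of_binary_def algebra_simps)
  moreover have "(\<Sum>(i, j)\<in>D. spin_of_binary S x i * \<theta> i j * spin_of_binary S x j) =
      4 * quad - 2 * lin - 2 * (\<Sum>(i, j)\<in>D. \<theta> i j * x j) + (\<Sum>(i, j)\<in>D. \<theta> i j)"
    unfolding quad_def lin_def sum_distrib_left sum_subtractf[symmetric] sum.distrib[symmetric]
    by (intro sum.cong) (auto simp: D_def spin_of_binary_def algebra_simps)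
  moreover have "(\<Sum>i\<in>S. binary_params S \<theta> i i * x i) = 2 * diag - 4 * lin"
    unfolding diag_def lin_rows sum_distrib_left[of 2] sum_distrib_left[of 4]
      sum_subtractf[symmetric]
    by (intro sum.cong) (auto simp: binary_params_def algebra_simps)
  moreover have "(\<Sum>(i, j)\<in>D. x i * binary_params S \<theta> i j * x j) = 4 * quad"
    unfolding quad_def sum_distrib_left
    by (intro sum.cong) (auto simp: D_def binary_params_def)
  ultimately show ?thesis
    unfolding utility_def D_def[symmetric] lin_swap by (simp add: sum_negf)
qed

lemma spin_ising_prob_eq_mvl_prob:
  assumes "finite S" and "\<theta> \<in> symmetric_matrices S"
  shows "spin_ising_prob S \<theta> b = mvl_prob S (binary_params S \<theta>) b"
proof -
  have "spin_ising_prob S \<theta> b =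
      mnl_prob (S \<rightarrow>\<^sub>E {- 1, 1}) (utility S \<theta>) (spin_of_binary S (binary_rep S b))"
    using \<open>finite S\<close> by (simp add: spin_ising_prob_def ising_prob_eq_mnl_prob spin_of_binary_rep)
  also have "\<dots> = mvl_prob S (binary_params S \<theta>) b"
    unfolding mvl_prob_def
    using utility_spin_of_binary[OF assms]
    by (intro mnl_prob_reindex_shift[OF bij_betw_spin_of_binary]) (auto simp: binary_rep_def)
  finally show ?thesis .
qed

theorem corollary1:
  fixes S :: "'a set"
  assumes "finite S"
  shows "(\<forall>\<theta>\<in>symmetric_matrices S. \<forall>b\<in>Pow S.
            binary_ising_prob S \<theta> b = mvl_prob S \<theta> b) \<and>
         (\<exists>F \<in> symmetric_matrices S \<rightarrow> symmetric_matrices S.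
          \<exists>G \<in> symmetric_matrices S \<rightarrow> symmetric_matrices S.
            (\<forall>\<theta>'\<in>symmetric_matrices S. \<forall>b\<in>Pow S.
               spin_ising_prob S \<theta>' b = mvl_prob S (F \<theta>') b) \<and>
            (\<forall>\<theta>\<in>symmetric_matrices S. \<forall>b\<in>Pow S.
               spin_ising_prob S (G \<theta>) b = mvl_prob S \<theta> b))"
proof (intro conjI)
  show "\<forall>\<theta>\<in>symmetric_matrices S. \<forall>b\<in>Pow S. binary_ising_prob S \<theta> b = mvl_prob S \<theta> b"
    using assms by (simp add: binary_ising_prob_def mvl_prob_def ising_prob_eq_mnl_prob)
  have F: "binary_params S \<in> symmetric_matrices S \<rightarrow> symmetric_matrices S"
    and G: "spin_params S \<in> symmetric_matrices S \<rightarrow> symmetric_matrices S"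
    by (auto intro: binary_params_symmetric spin_params_symmetric)
  have "spin_ising_prob S (spin_params S \<theta>) b = mvl_prob S \<theta> b"
    if "\<theta> \<in> symmetric_matrices S" for \<theta> b
    using spin_ising_prob_eq_mvl_prob[OF assms spin_params_symmetric[OF that]]
    by (simp add: binary_params_spin_params[OF that])
  then show "\<exists>F \<in> symmetric_matrices S \<rightarrow> symmetric_matrices S.
      \<exists>G \<in> symmetric_matrices S \<rightarrow> symmetric_matrices S.
        (\<forall>\<theta>'\<in>symmetric_matrices S. \<forall>b\<in>Pow S.
           spin_ising_prob S \<theta>' b = mvl_prob S (F \<theta>') b) \<and>
        (\<forall>\<theta>\<in>symmetric_matrices S. \<forall>b\<in>Pow S.
           spin_ising_prob S (G \<theta>) b = mvl_prob S \<theta> b)"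
    using spin_ising_prob_eq_mvl_prob[OF assms]
    by (intro bexI[OF _ F] bexI[OF _ G]) auto
qed

end
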